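(* Let $H_1,\dots,H_T$ be $T$ independent random histogram transforms with bin widths in $[\underline h_{0,n},\overline h_{0,n}]$, where $\underline h_{0,n}$ and $\overline h_{0,n}$ are of the same order, i.e. $c_{0,n}\overline h_{0,n}\le\underline h_{0,n}\le c_{0,n}^{-1}\overline h_{0,n}$ with constants $c_{0,n}\in(0,1)$ bounded away from $0$, and let $f_{\mathrm D,\mathrm E}=\frac1T\sum_{t=1}^Tf_{\mathrm D,H_t}$. Assume that the support $\mathcal X$ of $\mathrm P$ satisfies $\mathcal X\subset B_r\subset\mathbb R^d$ with $r\in(0,\infty)$ and that the density $f$ of $\mathrm P$ satisfies $f\in C^{0,\alpha}(B_r)$, $\alpha\in(0,1]$. Then, choosing $$\underline h_{0,n}:=(\log n/n)^{\frac1{2\alpha+d}},$$ there exists $N_0\in\mathbb N$ such that for all $n\ge N_0$, with probability $\nu_n=\mathrm P^n\otimes\mathrm P_H$ at least $1-\frac Tn$, $$\|f_{\mathrm D,\mathrm E}-f\|_{L_\infty(\mu)}\lesssim(\log n/n)^{\frac{\alpha}{2\alpha+d}},$$ where the $L_\infty(\mu)$-norm is taken over $x\in B^+_{r,\sqrt d\,\overline h_{0,n}}$.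
   Context: $\mu$ is Lebesgue measure on $\mathbb R^d$; $\mathrm P$ is a probability measure on $\mathbb R^d$ with support $\mathcal X$ and density $f$ with respect to $\mu$; $X_1,\dots,X_n$ are i.i.d. from $\mathrm P$ and $\mathrm D=\frac1n\sum_{i=1}^n\delta_{X_i}$. For $r>0$, $B_r=[-r,r]^d$, $B_r^c=\mathbb R^d\setminus B_r$, and for $\delta\in(0,r/2)$, $B^+_{r,\delta}=[\delta,r-\delta]^d$. $a_n\lesssim b_n$ means $a_n\le c\,b_n$ for all $n$ considered with a constant $c>0$ independent of $n$. $f\in C^{0,\alpha}(B_r)$ means that for some $c_L>0$, $|f(x)-f(x')|\le c_L\|x-x'\|^\alpha$ for all $x,x'\in B_r$. Histogram transform with bin widths in $[\underline h_0,\overline h_0]$: the random affine map $H(x)=R\,S\,x+b$, where $R$ is a uniformly distributed $d\times d$ rotation matrix ($R^\top=R^{-1}$, $\det R=1$), $S=\mathrm{diag}(s_1,\dots,s_d)$ with $\log s_i$ independent and uniform on $[\log(1/\overline h_0),\log(1/\underline h_0)]$, $b$ is uniform on $[0,1]^d$, and $R,S,b$ are independent of each other and of the data. In ensemble statements $\mathrm P_H$ denotes the joint law of $H_1,\dots,H_T$. The bin widths are $h_i=1/s_i\in[\underline h_0,\overline h_0]$. Bin of $x$: $A_H(x)=\{x'\in\mathbb R^d:\lfloor H(x')\rfloor=\lfloor H(x)\rfloor\}$ (coordinatewise floor). $(A_j)_{j\in\mathcal I_H}$ is the partition of $B_r$ consisting of the nonempty intersections of the bins with $B_r$, and $A_0:=B_r^c$.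 For a probability measure $\mathrm Q$, $f_{\mathrm Q,H}(x)=\mathrm Q(A_j)/\mu(A_j)$ for $x\in A_j$, $j\in\mathcal I_H\cup\{0\}$ (value $0$ on $A_0$). *)

theory Defs
  imports "HOL-Probability.Probability"
begin

definition cube :: "real \<Rightarrow> real \<Rightarrow> (real ^ 'd) set" where
  "cube a b = {x. \<forall>i. a \<le> x $ i \<and> x $ i \<le> b}"

lemma cube_eq_cbox: "cube a b = cbox (\<chi> i. a) (\<chi> i. b)"
  by (auto simp: cube_def mem_box_cart)

definition hoelder_on :: "real \<Rightarrow> (real ^ 'd) set \<Rightarrow> (real ^ 'd \<Rightarrow> real) \<Rightarrow> bool" where
  "hoelder_on \<alpha> A f \<longleftrightarrow>
     (\<exists>cL>0. \<forall>x\<in>A. \<forall>x'\<in>A. \<bar>f x - f x'\<bar> \<le> cL * norm (x - x') powr \<alpha>)"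

definition measure_support :: "'a::topological_space measure \<Rightarrow> 'a set" where
  "measure_support M = {x. \<forall>U. open U \<and> x \<in> U \<longrightarrow> emeasure M U > 0}"

text \<open>The norm takes values in \<^typ>\<open>ennreal\<close>, so that it is \<open>0\<close> on a null set \<open>A\<close>
  (as an extended real, the essential supremum would be \<open>-\<infinity>\<close> there).\<close>

definition Linf_norm_on :: "(real ^ 'd) set \<Rightarrow> (real ^ 'd \<Rightarrow> real) \<Rightarrow> ennreal" where
  "Linf_norm_on A g = esssup (restrict_space lborel A) (\<lambda>x. ennreal \<bar>g x\<bar>)"

text \<open>A transform is given by its rotation matrix, the diagonal of its scaling matrix and its
  translation vector.\<close>

type_synonym 'd hist_transform = "(real ^ 'd ^ 'd) \<times> (real ^ 'd) \<times> (real ^ 'd)"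

definition diag_matrix :: "real ^ 'd \<Rightarrow> real ^ 'd ^ 'd" where
  "diag_matrix s = (\<chi> i j. if i = j then s $ i else 0)"

definition hist_map :: "('d::finite) hist_transform \<Rightarrow> real ^ 'd \<Rightarrow> real ^ 'd" where
  "hist_map = (\<lambda>(R, s, b) x. (R ** diag_matrix s) *v x + b)"

text \<open>The uniform distribution on the rotation group is its normalised Haar measure: the unique
  Borel probability measure concentrated on the rotations and invariant under translation by
  rotations.  As the group is compact, invariance under left translation implies invariance under
  right translation.\<close>

definition uniform_rotation_law :: "(real ^ 'd ^ 'd::finite) measure \<Rightarrow> bool" where
  "uniform_rotation_law \<rho> \<longleftrightarrow>
     prob_space \<rho> \<and> sets \<rho> = sets borel \<and> (AE R in \<rho>. rotation_matrix R) \<and>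
     (\<forall>Q. rotation_matrix Q \<longrightarrow> distr \<rho> borel (\<lambda>R. Q ** R) = \<rho>)"

text \<open>On a one-point interval \<^const>\<open>uniform_measure\<close> would be the null measure; the uniform
  distribution is the point mass there.\<close>

definition uniform_interval :: "real \<Rightarrow> real \<Rightarrow> real measure" where
  "uniform_interval a b =
     (if a < b then uniform_measure lborel {a..b} else return borel a)"

definition scale_law :: "real \<Rightarrow> real \<Rightarrow> (real ^ 'd::finite) measure" where
  "scale_law hlo hup =
     distr (\<Pi>\<^sub>M i\<in>(UNIV :: 'd set). uniform_interval (ln (1 / hup)) (ln (1 / hlo))) borel
       (\<lambda>u. \<chi> i. exp (u i))"

definition shift_law :: "(real ^ 'd::finite) measure" where
  "shift_law = uniform_measure lborel (cube 0 1)"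

definition hist_law ::
  "(real ^ 'd ^ 'd::finite) measure \<Rightarrow> real \<Rightarrow> real \<Rightarrow> 'd hist_transform measure" where
  "hist_law \<rho> hlo hup = \<rho> \<Otimes>\<^sub>M scale_law hlo hup \<Otimes>\<^sub>M shift_law"

lemma sets_uniform_interval [measurable_cong, simp]: "sets (uniform_interval a b) = sets borel"
  by (simp add: uniform_interval_def)

lemma prob_space_uniform_interval: "prob_space (uniform_interval a b)"
  by (auto simp: uniform_interval_def prob_space_return intro!: prob_space_uniform_measure)

lemma prob_space_scale_law: "prob_space (scale_law hlo hup :: (real ^ 'd::finite) measure)"
  unfolding scale_law_def
proof (rule prob_space.prob_space_distr)
  show "prob_space (\<Pi>\<^sub>M i\<in>(UNIV :: 'd set). uniform_interval (ln (1 / hup)) (ln (1 / hlo)))"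
    by (intro prob_space_PiM prob_space_uniform_interval)
  have "(\<lambda>u. exp (u i)) \<in> borel_measurable
      (\<Pi>\<^sub>M i\<in>(UNIV :: 'd set). uniform_interval (ln (1 / hup)) (ln (1 / hlo)))" for i
    by measurable
  then show "(\<lambda>u. \<chi> i. exp (u i)) \<in> borel_measurable
      (\<Pi>\<^sub>M i\<in>(UNIV :: 'd set). uniform_interval (ln (1 / hup)) (ln (1 / hlo)))"
    by (subst borel_measurable_euclidean_space)
       (auto simp: Basis_vec_def inner_axis)
qed

lemma prob_space_shift_law: "prob_space (shift_law :: (real ^ 'd::finite) measure)"
proof -
  have "emeasure lborel (cube 0 1 :: (real ^ 'd) set) \<noteq> 0"
  proof -
    have "(\<Prod>b\<in>Basis. ((\<chi> i. 1) - (\<chi> i. 0) :: real ^ 'd) \<bullet> b) = (\<Prod>b\<in>(Basis :: (real ^ 'd) set). 1)"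
      by (intro prod.cong refl) (auto simp: Basis_vec_def inner_axis)
    then show ?thesis
      unfolding cube_eq_cbox by (subst emeasure_lborel_cbox) (auto simp: Basis_vec_def inner_axis)
  qed
  moreover have "emeasure lborel (cube 0 1 :: (real ^ 'd) set) \<noteq> \<infinity>"
    unfolding cube_eq_cbox using emeasure_lborel_cbox_finite by (simp add: less_top)
  ultimately show ?thesis
    unfolding shift_law_def by (rule prob_space_uniform_measure)
qed

lemma prob_space_hist_law:
  assumes "uniform_rotation_law \<rho>"
  shows "prob_space (hist_law \<rho> hlo hup)"
  using assms unfolding hist_law_def uniform_rotation_law_def
  by (intro prob_space_pair prob_space_scale_law prob_space_shift_law) auto

definition hist_bin :: "('d::finite) hist_transform \<Rightarrow> real ^ 'd \<Rightarrow> (real ^ 'd) set" where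
  "hist_bin H x = {x'. \<forall>i. \<lfloor>hist_map H x' $ i\<rfloor> = \<lfloor>hist_map H x $ i\<rfloor>}"

definition hist_cells :: "real \<Rightarrow> ('d::finite) hist_transform \<Rightarrow> (real ^ 'd) set set" where
  "hist_cells r H = {hist_bin H x \<inter> cube (- r) r | x. hist_bin H x \<inter> cube (- r) r \<noteq> {}}"

text \<open>For \<open>x\<close> in the cube, the cell containing \<open>x\<close> is the part of the bin of \<open>x\<close> inside
  the cube.\<close>

definition hist_density ::
  "real \<Rightarrow> (real ^ 'd) measure \<Rightarrow> ('d::finite) hist_transform \<Rightarrow> real ^ 'd \<Rightarrow> real" where
  "hist_density r Q H x =
     (if x \<in> cube (- r) r
      then measure Q (hist_bin H x \<inter> cube (- r) r) / measure lborel (hist_bin H x \<inter> cube (- r) r)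
      else 0)"

lemma partition_on_hist_cells: "partition_on (cube (- r) r) (hist_cells r H)"
proof (rule partition_onI)
  have "x \<in> \<Union> (hist_cells r H)" if "x \<in> cube (- r) r" for x
  proof -
    have "x \<in> hist_bin H x \<inter> cube (- r) r" using that by (simp add: hist_bin_def)
    then show ?thesis unfolding hist_cells_def by blast
  qed
  then show "\<Union> (hist_cells r H) = cube (- r) r"
    by (auto simp: hist_cells_def)
  show "disjnt A B" if "A \<in> hist_cells r H" "B \<in> hist_cells r H" "A \<noteq> B" for A B
    using that by (auto simp: hist_cells_def hist_bin_def disjnt_def)
qed (auto simp: hist_cells_def)

lemma hist_density_on_cell:
  assumes "A \<in> hist_cells r H" "x \<in> A"
  shows "hist_density r Q H x = measure Q A / measure lborel A"
proof -
  have "A = hist_bin H x \<inter> cube (- r) r" "x \<in> cube (- r) r"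
    using assms by (auto simp: hist_cells_def hist_bin_def)
  then show ?thesis by (simp add: hist_density_def)
qed

definition empirical_measure :: "nat \<Rightarrow> (nat \<Rightarrow> real ^ 'd) \<Rightarrow> (real ^ 'd) measure" where
  "empirical_measure n X = distr (uniform_count_measure {1..n}) borel X"

lemma emeasure_empirical_measure:
  assumes "A \<in> sets borel"
  shows "emeasure (empirical_measure n X) A =
           (\<Sum>i=1..n. emeasure (return borel (X i)) A) / of_nat n"
proof -
  have "emeasure (empirical_measure n X) A =
      emeasure (uniform_count_measure {1..n}) (X -` A \<inter> {1..n})"
    using assms unfolding empirical_measure_def
    by (subst emeasure_distr) (auto simp: space_uniform_count_measure
        measurable_def sets_uniform_count_measure)
  also have "\<dots> = of_nat (card (X -` A \<inter> {1..n})) / of_nat n"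
    by (cases "n = 0") (auto simp: emeasure_uniform_count_measure divide_ennreal
        ennreal_of_nat_eq_real_of_nat)
  also have "of_nat (card (X -` A \<inter> {1..n})) = (\<Sum>i=1..n. indicator A (X i) :: ennreal)"
    by (simp add: indicator_def sum.If_cases Int_commute vimage_def Int_def conj_commute)
  also have "\<dots> = (\<Sum>i=1..n. emeasure (return borel (X i)) A)"
    using assms by simp
  finally show ?thesis .
qed

definition ensemble_density ::
  "real \<Rightarrow> nat \<Rightarrow> nat \<Rightarrow> (nat \<Rightarrow> real ^ 'd) \<Rightarrow> (nat \<Rightarrow> ('d::finite) hist_transform)
     \<Rightarrow> real ^ 'd \<Rightarrow> real" where
  "ensemble_density r n T X H x =
     (1 / real T) * (\<Sum>t=1..T. hist_density r (empirical_measure n X) (H t) x)"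

text \<open>The law of the data \<open>X 1, \<dots>, X n\<close> and of the independent transforms \<open>H 1, \<dots>, H T\<close>.\<close>

definition sample_law ::
  "(real ^ 'd) measure \<Rightarrow> (real ^ 'd ^ 'd::finite) measure \<Rightarrow> nat \<Rightarrow> nat \<Rightarrow> real \<Rightarrow> real
     \<Rightarrow> ((nat \<Rightarrow> real ^ 'd) \<times> (nat \<Rightarrow> 'd hist_transform)) measure" where
  "sample_law P \<rho> n T hlo hup =
     (\<Pi>\<^sub>M i\<in>{1..n}. P) \<Otimes>\<^sub>M (\<Pi>\<^sub>M t\<in>{1..T}. hist_law \<rho> hlo hup)"

end

theory Submission
  imports Defs
begin

text \<open>
  The proof conditions on the transforms.  They are independent of the data, so by Fubini's theorem
  (\<open>measure_pair_ge_of_slices\<close>) it suffices to bound, for almost every fixed tuple of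
  transforms, the probability that the sample is bad.

  For a fixed transform the bins are fixed sets.  If the bin widths lie in \<open>[hlo, hup]\<close>, a bin
  has diameter at most \<open>sqrt d * hup\<close>, so the bins of the interior points considered lie
  entirely in the cube \<open>[- r, r]^d\<close>.  As they are disjoint and of volume at least of order
  \<open>hlo ^ d\<close>, there are only \<open>O(n)\<close> of them.  The estimator depends on the point only
  through its bin, so a union bound over these bins controls it uniformly in the point.

  The error at a point \<open>x\<close> with bin \<open>A\<close> is at most a bias, of order \<open>hup powr \<alpha>\<close> by
  Hoelder continuity on a set of that diameter, plus the deviation of the empirical frequency of
  \<open>A\<close> from its probability, divided by the volume of \<open>A\<close>.  Since \<open>f\<close> is bounded on the
  cube, the probability of \<open>A\<close> is \<open>O(h ^ d)\<close>; a Chernoff bound that sees this small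
  variance (\<open>emeasure_PiM_deviation_le\<close>) allows deviations of order
  \<open>sqrt (h ^ d * ln n / n)\<close> with failure probability \<open>O(n ^ - 3)\<close> for each bin.  After
  division by the volume this is \<open>sqrt (ln n / (n * h ^ d))\<close>, and the prescribed \<open>h\<close> is
  exactly the width at which this equals \<open>h powr \<alpha>\<close>.  The average over \<open>T\<close> transforms
  obeys the same error bound, with \<open>T\<close> times the failure probability
  (\<open>ensemble_density_finite_sample\<close>).

  A separate point is that the event in question has to be measurable for its probability to be
  meaningful.  The estimator is jointly measurable in sample, transforms and point, and the
  essential supremum is at most \<open>C\<close> iff a section of a measurable set is null
  (\<open>sets_Linf_norm_on_le\<close>).
\<close>

section \<open>Concentration of empirical frequencies\<close>

text \<open>On the negative side the bound is \<open>exp (- y) \<le> 1 / (1 + y)\<close> in disguise; having it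
  for both signs lets one moment estimate serve both tails.\<close>

lemma exp_le_quadratic:
  fixes x :: real
  assumes "\<bar>x\<bar> \<le> 1"
  shows "exp x \<le> 1 + x + x\<^sup>2"
proof (cases "0 \<le> x")
  case True
  then show ?thesis using exp_bound[of x] assms by auto
next
  case False
  define y where "y = - x"
  have y: "0 < y" "x = - y" using False by (auto simp: y_def)
  have "exp x * (1 + y) \<le> exp x * exp y"
    by (intro mult_left_mono exp_ge_add_one_self) auto
  also have "\<dots> = 1" using y by (simp flip: exp_add)
  also have "1 \<le> (1 - y + y\<^sup>2) * (1 + y)"
    using y by (simp add: algebra_simps power2_eq_square)
  finally show ?thesis using y by simp
qed

text \<open>The exponential moment of a centred Bernoulli variable carries the factor \<open>p = measure P A\<close>,
  that is, essentially its variance.  This factor is what makes the concentration bound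
  strong enough: the bins have mass of order \<open>h ^ d\<close>, and a bound for general
  \<open>[0, 1]\<close>-valued variables would ignore how small that is.\<close>

lemma nn_integral_exp_centred_indicator_le:
  assumes "prob_space P" and A [measurable]: "A \<in> sets P" and s: "\<bar>s\<bar> \<le> 1"
  shows "(\<integral>\<^sup>+x. ennreal (exp (s * (indicator A x - measure P A))) \<partial>P)
    \<le> ennreal (exp (measure P A * s\<^sup>2))"
proof -
  interpret prob_space P by fact
  define p where "p = measure P A"
  have eq: "exp (s * (indicator A x - p)) = exp (- s * p) * (1 + (exp s - 1) * indicator A x)"
    for x
    by (auto simp: indicator_def algebra_simps simp flip: exp_add)
  have int: "integrable P (\<lambda>x. exp (s * (indicator A x - p)))"
    unfolding eq
    by (intro integrable_mult_right Bochner_Integration.integrable_add integrable_const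
        integrable_real_indicator A) (simp add: less_top[symmetric])
  have "(\<integral>\<^sup>+x. ennreal (exp (s * (indicator A x - p))) \<partial>P)
      = ennreal (\<integral>x. exp (s * (indicator A x - p)) \<partial>P)"
    using int by (intro nn_integral_eq_integral) auto
  also have "(\<integral>x. exp (s * (indicator A x - p)) \<partial>P) = exp (- s * p) * (1 + (exp s - 1) * p)"
    unfolding eq
    by (subst integral_mult_right_zero, subst Bochner_Integration.integral_add)
      (auto simp: prob_space emeasure_eq_measure p_def)
  also have "\<dots> \<le> exp (- s * p) * exp ((exp s - 1) * p)"
    by (intro mult_left_mono exp_ge_add_one_self) auto
  also have "\<dots> = exp (p * (exp s - 1 - s))"
    by (simp add: algebra_simps flip: exp_add)
  also have "\<dots> \<le> exp (p * s\<^sup>2)"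
    using exp_le_quadratic[OF s] by (auto simp: p_def intro!: mult_left_mono)
  finally show ?thesis by (simp add: p_def ennreal_leI)
qed

text \<open>Chernoff's method: the exponential moment of the sum factorises over the product measure.
  The sign \<open>\<sigma>\<close> selects the upper or the lower tail.\<close>

lemma emeasure_PiM_upper_deviation_le:
  fixes I :: "'i set"
  assumes P: "prob_space P" and A: "A \<in> sets P" and I: "finite I"
    and s: "0 < s" "s \<le> 1" and \<sigma>: "\<bar>\<sigma>\<bar> = 1"
  shows "emeasure (\<Pi>\<^sub>M i\<in>I. P) {x \<in> space (\<Pi>\<^sub>M i\<in>I. P).
            a \<le> (\<Sum>i\<in>I. \<sigma> * (indicator A (x i) - measure P A))}
    \<le> ennreal (exp (real (card I) * (measure P A * s\<^sup>2) - s * a))"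
proof -
  interpret prob_space P by fact
  interpret product_sigma_finite "\<lambda>_::'i. P" ..
  note [measurable] = A
  define p where "p = measure P A"
  let ?M = "\<Pi>\<^sub>M i\<in>I. P"
  let ?S = "\<lambda>x. \<Sum>i\<in>I. \<sigma> * (indicator A (x i) - p)"
  have "emeasure ?M {x \<in> space ?M. a \<le> ?S x}
      \<le> ennreal (exp (- s * a)) * (\<integral>\<^sup>+x. ennreal (exp (s * ?S x)) * indicator (space ?M) x \<partial>?M)"
    using s by (intro Chernoff_ineq_nn_integral_ge) auto
  also have "(\<integral>\<^sup>+x. ennreal (exp (s * ?S x)) * indicator (space ?M) x \<partial>?M)
      = (\<integral>\<^sup>+x. (\<Prod>i\<in>I. ennreal (exp ((s * \<sigma>) * (indicator A (x i) - p)))) \<partial>?M)"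
    using I by (intro nn_integral_cong)
      (simp add: prod_ennreal sum_distrib_left mult.assoc flip: exp_sum)
  also have "\<dots> = (\<Prod>i\<in>I. \<integral>\<^sup>+x. ennreal (exp ((s * \<sigma>) * (indicator A x - p))) \<partial>P)"
    using I by (intro product_nn_integral_prod) auto
  also have "\<dots> \<le> (\<Prod>i\<in>I. ennreal (exp (p * (s * \<sigma>)\<^sup>2)))"
    unfolding p_def using s \<sigma>
    by (intro prod_mono_ennreal nn_integral_exp_centred_indicator_le P A) (auto simp: abs_mult)
  also have "\<dots> = ennreal (exp (real (card I) * (p * s\<^sup>2)))"
    using \<sigma> abs_square_eq_1[of \<sigma>] by (simp add: power_mult_distrib ennreal_power exp_of_nat_mult)
  also have "ennreal (exp (- s * a)) * ennreal (exp (real (card I) * (p * s\<^sup>2)))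
      = ennreal (exp (real (card I) * (p * s\<^sup>2) - s * a))"
    by (simp add: algebra_simps flip: ennreal_mult exp_add)
  finally show ?thesis by (simp add: p_def mult_left_mono)
qed

lemma emeasure_PiM_deviation_le:
  fixes I :: "'i set"
  assumes P: "prob_space P" and A: "A \<in> sets P" and I: "finite I"
    and s: "0 < s" "s \<le> 1"
  shows "emeasure (\<Pi>\<^sub>M i\<in>I. P) {x \<in> space (\<Pi>\<^sub>M i\<in>I. P).
            a \<le> \<bar>\<Sum>i\<in>I. indicator A (x i) - measure P A\<bar>}
    \<le> ennreal (2 * exp (real (card I) * (measure P A * s\<^sup>2) - s * a))"
proof -
  note [measurable] = A
  let ?M = "\<Pi>\<^sub>M i\<in>I. P" and ?e = "exp (real (card I) * (measure P A * s\<^sup>2) - s * a)"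
  let ?B = "\<lambda>\<sigma>. {x \<in> space ?M. a \<le> (\<Sum>i\<in>I. \<sigma> * (indicator A (x i) - measure P A))}"
  have "{x \<in> space ?M. a \<le> \<bar>\<Sum>i\<in>I. indicator A (x i) - measure P A\<bar>} \<subseteq> ?B 1 \<union> ?B (- 1)"
    unfolding sum_distrib_left[symmetric] by auto
  then have "emeasure ?M {x \<in> space ?M. a \<le> \<bar>\<Sum>i\<in>I. indicator A (x i) - measure P A\<bar>}
      \<le> emeasure ?M (?B 1 \<union> ?B (- 1))"
    by (intro emeasure_mono) measurable
  also have "\<dots> \<le> emeasure ?M (?B 1) + emeasure ?M (?B (- 1))"
    by (intro emeasure_subadditive) measurable
  also have "\<dots> \<le> ennreal ?e + ennreal ?e"
    by (intro add_mono emeasure_PiM_upper_deviation_le assms) auto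
  finally show ?thesis by (simp flip: ennreal_plus)
qed

section \<open>Geometry of the bins\<close>

text \<open>The transforms to which the deterministic geometry of the bins applies; they have full measure
  under the law of the transforms.\<close>

definition admissible_transform :: "real \<Rightarrow> real \<Rightarrow> ('d::finite) hist_transform \<Rightarrow> bool" where
  "admissible_transform hlo hup = (\<lambda>(R, s, b).
     orthogonal_matrix R \<and> (\<forall>i. 1 / hup \<le> s $ i \<and> s $ i \<le> 1 / hlo))"

lemma mem_hist_bin_iff:
  "x' \<in> hist_bin H x \<longleftrightarrow> (\<forall>i. \<lfloor>hist_map H x' $ i\<rfloor> = \<lfloor>hist_map H x $ i\<rfloor>)"
  by (simp add: hist_bin_def)

lemma hist_bin_eq: "z \<in> hist_bin H x \<Longrightarrow> hist_bin H z = hist_bin H x"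
  by (simp add: hist_bin_def)

lemma norm_orthogonal_matrix_mult:
  assumes "orthogonal_matrix (R :: real ^ 'd ^ 'd::finite)"
  shows "norm (R *v z) = norm z"
  using assms orthogonal_transformation_matrix[of "(*v) R"] orthogonal_transformation_norm
  by (metis matrix_of_matrix_vector_mul matrix_vector_mul_linear)

lemma diag_matrix_mult_nth: "(diag_matrix s *v z) $ i = s $ i * (z $ i :: real)"
  by (simp add: diag_matrix_def matrix_vector_mult_def if_distrib[of "\<lambda>a. a * _"] sum.delta
      cong: if_cong)

text \<open>Two points of a bin have images at distance at most \<open>sqrt d\<close>, since they lie in the same
  unit cube; undoing the rotation preserves the distance and undoing the scaling expands it by at
  most \<open>hup\<close>.\<close>

lemma hist_bin_diameter_le:
  fixes H :: "('d::finite) hist_transform"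
  assumes H: "admissible_transform hlo hup H" and h: "0 < hup"
    and x': "x' \<in> hist_bin H x"
  shows "norm (x' - x) \<le> sqrt (real CARD('d)) * hup"
proof -
  obtain R s b where Heq: "H = (R, s, b)" by (cases H)
  define z where "z = diag_matrix s *v (x' - x)"
  have R: "orthogonal_matrix R" and s: "1 / hup \<le> s $ i" for i
    using H by (auto simp: admissible_transform_def Heq)
  have diff: "hist_map H x' - hist_map H x = R *v z"
    by (simp add: hist_map_def Heq z_def matrix_vector_mul_assoc[symmetric]
        matrix_vector_mult_diff_distrib)
  have "\<bar>(R *v z) $ i\<bar> \<le> 1" for i
  proof -
    have "\<lfloor>hist_map H x' $ i\<rfloor> = \<lfloor>hist_map H x $ i\<rfloor>" using x' by (simp add: mem_hist_bin_iff)
    then have "\<bar>hist_map H x' $ i - hist_map H x $ i\<bar> \<le> 1" by linarith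
    then show ?thesis by (simp add: diff[symmetric])
  qed
  then have "(\<Sum>i\<in>UNIV. ((R *v z) $ i)\<^sup>2) \<le> (\<Sum>i\<in>(UNIV::'d set). 1)"
    by (intro sum_mono) (simp add: abs_square_le_1)
  then have Rz: "norm (R *v z) \<le> sqrt (real CARD('d))"
    by (simp add: norm_vec_def L2_set_def)
  have "norm (x' - x) \<le> norm (hup *\<^sub>R z)"
  proof (rule norm_le_componentwise_cart)
    fix i
    have "1 \<le> hup * s $ i" using s[of i] h by (simp add: field_simps)
    then have "1 * \<bar>(x' - x) $ i\<bar> \<le> \<bar>hup * s $ i\<bar> * \<bar>(x' - x) $ i\<bar>"
      by (intro mult_right_mono) auto
    then show "norm ((x' - x) $ i) \<le> norm ((hup *\<^sub>R z) $ i)"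
      by (simp add: z_def diag_matrix_mult_nth abs_mult mult.assoc del: vector_minus_component)
  qed
  also have "\<dots> = hup * norm (R *v z)" using h by (simp add: norm_orthogonal_matrix_mult[OF R])
  also have "\<dots> \<le> hup * sqrt (real CARD('d))" using Rz h by (intro mult_left_mono) auto
  finally show ?thesis by (simp add: mult.commute)
qed

lemma borel_measurable_vec_nth [measurable]: "(\<lambda>x :: real ^ 'd::finite. x $ i) \<in> borel_measurable borel"
  by (intro borel_measurable_continuous_onI continuous_intros)

lemma borel_measurable_matrix_nth [measurable]:
  "(\<lambda>R :: real ^ 'd::finite ^ 'e::finite. R $ i $ j) \<in> borel_measurable borel"
  by (intro borel_measurable_continuous_onI continuous_intros)

lemma hist_map_nth:
  "hist_map H x $ i
    = (\<Sum>j\<in>UNIV. fst H $ i $ j * (fst (snd H) $ j * x $ j)) + snd (snd H) $ i"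
proof -
  obtain R s b where H: "H = (R, s, b)" by (cases H)
  have "hist_map H x = R *v (diag_matrix s *v x) + b"
    by (simp add: H hist_map_def matrix_vector_mul_assoc)
  moreover have "(R *v z) $ i = (\<Sum>j\<in>UNIV. R $ i $ j * z $ j)" for z
    by (simp add: matrix_vector_mult_def)
  ultimately show ?thesis by (simp add: H diag_matrix_mult_nth)
qed

lemma sets_hist_bin [measurable]: "hist_bin H x \<in> sets borel"
  unfolding hist_bin_def hist_map_nth by measurable

lemma sets_cube [measurable]: "cube a b \<in> sets borel"
  by (simp add: cube_eq_cbox)

lemma measure_lborel_centred_cube:
  fixes x :: "real ^ 'd::finite"
  assumes "0 \<le> t"
  shows "measure lborel (cbox (x - (\<chi> i. t)) (x + (\<chi> i. t))) = (2 * t) ^ CARD('d)"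
    and "measure lborel (box (x - (\<chi> i. t)) (x + (\<chi> i. t))) = (2 * t) ^ CARD('d)"
proof -
  let ?l = "x - (\<chi> i. t)" and ?u = "x + (\<chi> i. t)"
  have side: "(?u - ?l) \<bullet> b = 2 * t" if "b \<in> Basis" for b
    using that by (auto simp: Basis_vec_def inner_axis)
  have le: "\<forall>b\<in>Basis. ?l \<bullet> b \<le> ?u \<bullet> b"
  proof
    fix b :: "real ^ 'd" assume "b \<in> Basis"
    then have "0 \<le> (?u - ?l) \<bullet> b" using assms by (simp only: side)
    then show "?l \<bullet> b \<le> ?u \<bullet> b" by (simp only: inner_diff_left)
  qed
  have "(\<Prod>b\<in>Basis. (?u - ?l) \<bullet> b) = (2 * t) ^ CARD('d)"
    by (simp only: side prod_constant cong: prod.cong) simp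
  then show "measure lborel (cbox ?l ?u) = (2 * t) ^ CARD('d)"
      "measure lborel (box ?l ?u) = (2 * t) ^ CARD('d)"
    using le by (simp_all add: content_cbox' measure_lborel_box)
qed

lemma bounded_hist_bin:
  assumes "admissible_transform hlo hup H" "0 < hup"
  shows "bounded (hist_bin H x)"
  using hist_bin_diameter_le[OF assms] unfolding bounded_def
  by (metis dist_commute dist_norm)

lemma fmeasurable_hist_bin:
  assumes "admissible_transform hlo hup H" "0 < hup"
  shows "hist_bin H x \<in> fmeasurable lborel"
  using emeasure_bounded_finite[OF bounded_hist_bin[OF assms]] by (intro fmeasurableI) auto

text \<open>The exact volume of a bin is the product of the bin widths.  Only its order of magnitude matters
  for the rates, so it is compared with axis-parallel cubes: a bin of bounded diameter fits into a
  cube, and (\<open>measure_hist_bin_ge\<close>) a bin contains a cube around the preimage of the centre of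
  its unit cube.\<close>

lemma measure_hist_bin_le:
  fixes H :: "('d::finite) hist_transform"
  assumes H: "admissible_transform hlo hup H" and h: "0 < hup"
  shows "measure lborel (hist_bin H x) \<le> (2 * (sqrt (real CARD('d)) * hup)) ^ CARD('d)"
proof -
  define t where "t = sqrt (real CARD('d)) * hup"
  have "y \<in> cbox (x - (\<chi> i. t)) (x + (\<chi> i. t))" if "y \<in> hist_bin H x" for y
  proof -
    have "\<bar>(y - x) $ i\<bar> \<le> t" for i
      using component_le_norm_cart[of "y - x" i] hist_bin_diameter_le[OF H h that]
      by (simp add: t_def)
    then show ?thesis by (simp add: mem_box_cart abs_le_iff algebra_simps)
  qed
  then have "measure lborel (hist_bin H x) \<le> measure lborel (cbox (x - (\<chi> i. t)) (x + (\<chi> i. t)))"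
    by (intro measure_mono_fmeasurable) auto
  also have "\<dots> = (2 * t) ^ CARD('d)"
    using h by (intro measure_lborel_centred_cube) (simp add: t_def)
  finally show ?thesis by (simp add: t_def)
qed

lemma measure_hist_bin_ge:
  fixes H :: "('d::finite) hist_transform"
  assumes H: "admissible_transform hlo hup H" and h: "0 < hlo" "0 < hup"
  shows "(hlo / sqrt (real CARD('d))) ^ CARD('d) \<le> measure lborel (hist_bin H x)"
proof -
  obtain R s b where Heq: "H = (R, s, b)" by (cases H)
  have R: "orthogonal_matrix R" and s: "1 / hup \<le> s $ i" "s $ i \<le> 1 / hlo" for i
    using H by (auto simp: admissible_transform_def Heq)
  have spos: "0 < s $ i" for i
    using s(1)[of i] h by (meson divide_pos_pos less_le_trans zero_less_one)
  have d: "0 < sqrt (real CARD('d))" by (simp add: card_gt_0_iff)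
  \<comment> \<open>A cube with half side \<open>t\<close> lies within Euclidean distance \<open>hlo / 2\<close> of its centre, so
    its image stays within distance \<open>1 / 2\<close> of the centre of the unit cube.\<close>
  define t where "t = hlo / (2 * sqrt (real CARD('d)))"
  define m :: "real ^ 'd" where "m = (\<chi> i. of_int \<lfloor>hist_map H x $ i\<rfloor> + 1 / 2)"
  define w where "w = transpose R *v (m - b)"
  define z :: "real ^ 'd" where "z = (\<chi> i. w $ i / s $ i)"
  have "diag_matrix s *v z = w"
    using spos by (simp add: vec_eq_iff diag_matrix_mult_nth z_def less_imp_neq[symmetric])
  moreover have "R *v w = m - b"
    using R by (simp only: w_def matrix_vector_mul_assoc orthogonal_matrix_def matrix_vector_mul_lid)
  ultimately have centre: "hist_map H z = m"
    by (simp add: hist_map_def Heq matrix_vector_mul_assoc[symmetric])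
  have "y \<in> hist_bin H x" if y: "y \<in> box (z - (\<chi> i. t)) (z + (\<chi> i. t))" for y
  proof -
    define q where "q = diag_matrix s *v (y - z)"
    have yi: "\<bar>(y - z) $ i\<bar> < t" for i
      using y by (auto simp: mem_box_cart abs_less_iff algebra_simps)
    have qi: "\<bar>q $ i\<bar> < t / hlo" for i
    proof -
      have "\<bar>q $ i\<bar> = s $ i * \<bar>(y - z) $ i\<bar>"
        using spos[of i] by (simp add: q_def diag_matrix_mult_nth abs_mult
            del: vector_minus_component)
      also have "\<dots> < s $ i * t" using yi spos by (intro mult_strict_left_mono)
      also have "\<dots> \<le> 1 / hlo * t"
        using s(2)[of i] h d by (intro mult_right_mono) (auto simp: t_def)
      finally show ?thesis by simp
    qed
    have sq: "(q $ i)\<^sup>2 < (t / hlo)\<^sup>2" for i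
      using power_strict_mono[OF qi, of i 2] by simp
    have "(\<Sum>i\<in>UNIV. (q $ i)\<^sup>2) < (\<Sum>i\<in>(UNIV::'d set). (t / hlo)\<^sup>2)"
      using qi by (intro sum_strict_mono) (auto simp: sq)
    also have "\<dots> = (1 / 2)\<^sup>2"
      using h by (simp add: t_def power_divide power_mult_distrib)
    finally have "sqrt (\<Sum>i\<in>UNIV. (q $ i)\<^sup>2) < 1 / 2"
      by (intro real_less_lsqrt) auto
    then have "norm q < 1 / 2"
      by (simp add: norm_vec_def L2_set_def)
    then have "norm (R *v q) < 1 / 2" by (simp add: norm_orthogonal_matrix_mult[OF R])
    moreover have "hist_map H y - m = R *v q"
      by (simp add: centre[symmetric] q_def hist_map_def Heq matrix_vector_mul_assoc[symmetric]
          matrix_vector_mult_diff_distrib)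
    ultimately have "norm (hist_map H y - m) < 1 / 2" by simp
    then have "\<bar>(hist_map H y - m) $ i\<bar> < 1 / 2" for i
      using component_le_norm_cart[of "hist_map H y - m" i] by linarith
    then have mid: "\<bar>hist_map H y $ i - (of_int \<lfloor>hist_map H x $ i\<rfloor> + 1 / 2)\<bar> < 1 / 2" for i
      by (simp add: m_def)
    have "\<lfloor>hist_map H y $ i\<rfloor> = \<lfloor>hist_map H x $ i\<rfloor>" for i
      using mid[of i] by (intro floor_unique) linarith+
    then show ?thesis by (simp add: mem_hist_bin_iff)
  qed
  then have "measure lborel (box (z - (\<chi> i. t)) (z + (\<chi> i. t))) \<le> measure lborel (hist_bin H x)"
    using bounded_hist_bin[OF H h(2), of x]
    by (intro measure_mono_fmeasurable) (auto intro: fmeasurable_hist_bin[OF H h(2)])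
  moreover have "measure lborel (box (z - (\<chi> i. t)) (z + (\<chi> i. t))) = (2 * t) ^ CARD('d)"
    using h d by (intro measure_lborel_centred_cube) (simp add: t_def)
  ultimately show ?thesis by (simp add: t_def)
qed

definition bins_within :: "real \<Rightarrow> ('d::finite) hist_transform \<Rightarrow> (real ^ 'd) set set" where
  "bins_within r H = {hist_bin H x | x. hist_bin H x \<subseteq> cube (- r) r}"

text \<open>The bins inside the cube are disjoint, and each has at least the volume from
  \<open>measure_hist_bin_ge\<close>; compare with the volume of the cube.\<close>

lemma card_bins_within_le:
  fixes H :: "('d::finite) hist_transform"
  assumes H: "admissible_transform hlo hup H" and h: "0 < hlo" "0 < hup" and r: "0 \<le> r"
  shows "finite (bins_within r H)"
    and "real (card (bins_within r H))
      \<le> (2 * r) ^ CARD('d) / (hlo / sqrt (real CARD('d))) ^ CARD('d)"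
proof -
  let ?v = "(hlo / sqrt (real CARD('d))) ^ CARD('d)"
  let ?q = "(2 * r) ^ CARD('d) / ?v"
  have v: "0 < ?v" using h by (simp add: card_gt_0_iff)
  have bdd: "real (card G) \<le> ?q" if G: "G \<subseteq> bins_within r H" "finite G" for G
  proof -
    have meas: "A \<in> sets borel" "emeasure lborel A < \<infinity>" "?v \<le> measure lborel A"
      "A \<subseteq> cube (- r) r" if "A \<in> G" for A
    proof -
      obtain x where "A = hist_bin H x" "A \<subseteq> cube (- r) r"
        using \<open>A \<in> G\<close> G by (auto simp: bins_within_def)
      then show "A \<in> sets borel" "emeasure lborel A < \<infinity>" "?v \<le> measure lborel A"
          "A \<subseteq> cube (- r) r"
        using measure_hist_bin_ge[OF H h] emeasure_bounded_finite[OF bounded_hist_bin[OF H h(2)]]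
        by auto
    qed
    have disj: "disjoint_family_on (\<lambda>A. A) G"
      unfolding disjoint_family_on_def
    proof (intro ballI impI)
      fix A B assume AB: "A \<in> G" "B \<in> G" "A \<noteq> B"
      then obtain x y where "A = hist_bin H x" "B = hist_bin H y"
        using G(1) unfolding bins_within_def by blast
      then show "A \<inter> B = {}" using AB hist_bin_eq by blast
    qed
    have "real (card G) * ?v \<le> (\<Sum>A\<in>G. measure lborel A)"
      using sum_mono[of G "\<lambda>_. ?v" "measure lborel"] meas by simp
    also have "\<dots> = measure lborel (\<Union>A\<in>G. A)"
      using G disj meas by (intro measure_finite_Union[symmetric]) (auto simp: less_top)
    also have "\<dots> \<le> measure lborel (cube (- r) r :: (real ^ 'd) set)"
    proof (rule measure_mono_fmeasurable)
      show "(\<Union>A\<in>G. A) \<subseteq> cube (- r) r" using meas(4) by blast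
      show "(\<Union>A\<in>G. A) \<in> sets lborel" using meas G by auto
    qed (simp add: cube_eq_cbox)
    also have "(cube (- r) r :: (real ^ 'd) set) = cbox (0 - (\<chi> i. r)) (0 + (\<chi> i. r) :: real ^ 'd)"
      by (auto simp: cube_def mem_box_cart)
    also have "measure lborel \<dots> = (2 * r) ^ CARD('d)"
      by (rule measure_lborel_centred_cube[OF r])
    finally show ?thesis using v by (simp add: pos_le_divide_eq)
  qed
  have "card G \<le> nat \<lfloor>?q\<rfloor>" if "G \<subseteq> bins_within r H" "finite G" for G
    using bdd[OF that] by (simp add: le_nat_floor)
  from finite_if_finite_subsets_card_bdd[OF this] show "finite (bins_within r H)" by blast
  then show "real (card (bins_within r H)) \<le> ?q" using bdd by blast
qed

section \<open>Measurability of the ensemble estimator and of its error\<close>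

text \<open>A reference space carrying the sets of every law of a transform, whatever the rotation law and
  the bin widths.\<close>

abbreviation borel_hist :: "('d::finite) hist_transform measure" where
  "borel_hist \<equiv> borel \<Otimes>\<^sub>M (borel \<Otimes>\<^sub>M borel)"

lemma sets_hist_law [measurable_cong]:
  assumes "uniform_rotation_law \<rho>"
  shows "sets (hist_law \<rho> hlo hup) = sets borel_hist"
  using assms unfolding hist_law_def uniform_rotation_law_def
  by (intro sets_pair_measure_cong) (auto simp: scale_law_def shift_law_def)

lemma measurable_hist_map_nth [measurable]:
  fixes g :: "'a \<Rightarrow> ('d::finite) hist_transform"
  assumes [measurable]: "g \<in> N \<rightarrow>\<^sub>M borel_hist" "k \<in> N \<rightarrow>\<^sub>M borel"
  shows "(\<lambda>\<omega>. hist_map (g \<omega>) (k \<omega>) $ i) \<in> borel_measurable N"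
  unfolding hist_map_nth by measurable

lemma pred_mem_hist_bin [measurable]:
  fixes g :: "'a \<Rightarrow> ('d::finite) hist_transform"
  assumes [measurable]: "g \<in> N \<rightarrow>\<^sub>M borel_hist" "k \<in> N \<rightarrow>\<^sub>M borel" "l \<in> N \<rightarrow>\<^sub>M borel"
  shows "Measurable.pred N (\<lambda>\<omega>. l \<omega> \<in> hist_bin (g \<omega>) (k \<omega>))"
  unfolding mem_hist_bin_iff by measurable

text \<open>The volume is that of a section of a measurable set in the product with \<^const>\<open>lborel\<close>.\<close>

lemma borel_measurable_measure_hist_bin [measurable]:
  fixes g :: "'a \<Rightarrow> ('d::finite) hist_transform"
  assumes [measurable]: "g \<in> N \<rightarrow>\<^sub>M borel_hist" "k \<in> N \<rightarrow>\<^sub>M borel"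
  shows "(\<lambda>\<omega>. measure lborel (hist_bin (g \<omega>) (k \<omega>) \<inter> cube (- r) r)) \<in> borel_measurable N"
proof -
  let ?Q = "{p \<in> space (N \<Otimes>\<^sub>M lborel). snd p \<in> hist_bin (g (fst p)) (k (fst p)) \<and>
    snd p \<in> cube (- r) r}"
  have "?Q \<in> sets (N \<Otimes>\<^sub>M lborel)" by measurable
  from lborel.measurable_emeasure_Pair[OF this]
  have "(\<lambda>\<omega>. enn2real (emeasure lborel (Pair \<omega> -` ?Q))) \<in> borel_measurable N" by simp
  moreover have "Pair \<omega> -` ?Q = hist_bin (g \<omega>) (k \<omega>) \<inter> cube (- r) r" if "\<omega> \<in> space N" for \<omega>
    using that by (auto simp: space_pair_measure)
  ultimately show ?thesis
    by (simp add: measure_def cong: measurable_cong)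
qed

lemma measure_empirical_measure:
  assumes "A \<in> sets borel"
  shows "measure (empirical_measure n X) A = (\<Sum>i=1..n. indicator A (X i)) / real n"
proof (cases "n = 0")
  case True
  then show ?thesis
    by (simp add: measure_def emeasure_empirical_measure[OF assms])
next
  case False
  have "emeasure (empirical_measure n X) A
      = ennreal (\<Sum>i=1..n. indicator A (X i)) / ennreal (real n)"
    using assms
    by (simp add: emeasure_empirical_measure ennreal_indicator ennreal_of_nat_eq_real_of_nat
        flip: sum_ennreal)
  also have "\<dots> = ennreal ((\<Sum>i=1..n. indicator A (X i)) / real n)"
    using False by (intro divide_ennreal) (auto intro: sum_nonneg)
  finally show ?thesis
    by (simp add: measure_def sum_nonneg)
qed

lemma hist_density_empirical:
  "hist_density r (empirical_measure n X) H x =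
     (if x \<in> cube (- r) r
      then (\<Sum>i=1..n. indicator (hist_bin H x \<inter> cube (- r) r) (X i)) / real n
        / measure lborel (hist_bin H x \<inter> cube (- r) r)
      else 0)"
  by (simp add: hist_density_def measure_empirical_measure)

lemma borel_measurable_ensemble_density:
  fixes P :: "(real ^ 'd::finite) measure" and M :: "'d hist_transform measure"
  assumes [measurable_cong]: "sets P = sets borel" "sets M = sets borel_hist"
  shows "(\<lambda>p. ensemble_density r n T (fst (fst p)) (snd (fst p)) (snd p)) \<in> borel_measurable
     (((\<Pi>\<^sub>M i\<in>{1..n}. P) \<Otimes>\<^sub>M (\<Pi>\<^sub>M t\<in>{1..T}. M)) \<Otimes>\<^sub>M borel)"
proof -
  let ?N = "((\<Pi>\<^sub>M i\<in>{1..n}. P) \<Otimes>\<^sub>M (\<Pi>\<^sub>M t\<in>{1..T}. M)) \<Otimes>\<^sub>M borel"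
  have [measurable]: "(\<lambda>p. fst (fst p) i) \<in> ?N \<rightarrow>\<^sub>M borel" if "i \<in> {1..n}" for i
    using that by measurable
  have [measurable]: "(\<lambda>p. snd (fst p) t) \<in> ?N \<rightarrow>\<^sub>M borel_hist" if "t \<in> {1..T}" for t
    using that by measurable
  have [measurable]: "(\<lambda>p. indicat_real (hist_bin (snd (fst p) t) (snd p) \<inter> cube (- r) r) (fst (fst p) i))
      \<in> borel_measurable ?N" if "i \<in> {1..n}" "t \<in> {1..T}" for i t
    using that unfolding indicator_def Int_iff by measurable
  show ?thesis
    unfolding ensemble_density_def hist_density_empirical
    by measurable
qed

text \<open>In terms of a null set the event can be read off from sections, which yields its measurability
  in the next lemma.\<close>

lemma Linf_norm_on_le_iff:
  assumes [measurable]: "g \<in> borel_measurable borel" "A \<in> sets borel"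
  shows "Linf_norm_on A g \<le> C \<longleftrightarrow> emeasure lborel {x \<in> A. C < ennreal \<bar>g x\<bar>} = 0"
proof -
  have meas: "(\<lambda>x. ennreal \<bar>g x\<bar>) \<in> borel_measurable (restrict_space lborel A)"
    by (intro measurable_restrict_space1) simp
  have "Linf_norm_on A g \<le> C \<longleftrightarrow> (AE x in restrict_space lborel A. ennreal \<bar>g x\<bar> \<le> C)"
    unfolding Linf_norm_on_def
    using esssup_AE[where f="\<lambda>x. ennreal \<bar>g x\<bar>" and M="restrict_space lborel A"] meas
    by (auto intro!: esssup_I elim!: eventually_mono)
  also have "\<dots> \<longleftrightarrow> (AE x in lborel. x \<in> A \<longrightarrow> ennreal \<bar>g x\<bar> \<le> C)"
    by (rule AE_restrict_space_iff) simp
  also have "\<dots> \<longleftrightarrow> emeasure lborel {x \<in> A. C < ennreal \<bar>g x\<bar>} = 0"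
    by (subst AE_iff_measurable[OF _ refl]) (auto simp: not_le)
  finally show ?thesis .
qed

lemma sets_Linf_norm_on_le:
  assumes g [measurable]: "(\<lambda>p. g (fst p) (snd p)) \<in> borel_measurable (N \<Otimes>\<^sub>M borel)"
    and A [measurable]: "A \<in> sets borel"
  shows "{\<omega> \<in> space N. Linf_norm_on A (g \<omega>) \<le> C} \<in> sets N"
proof -
  let ?Q = "{p \<in> space (N \<Otimes>\<^sub>M lborel). snd p \<in> A \<and> C < ennreal \<bar>g (fst p) (snd p)\<bar>}"
  have [measurable]: "(\<lambda>p. g (fst p) (snd p)) \<in> borel_measurable (N \<Otimes>\<^sub>M lborel)"
    using g by (simp cong: measurable_cong_sets sets_pair_measure_cong)
  have "?Q \<in> sets (N \<Otimes>\<^sub>M lborel)" by measurable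
  note [measurable] = lborel.measurable_emeasure_Pair[OF this]
  have "{\<omega> \<in> space N. Linf_norm_on A (g \<omega>) \<le> C}
      = {\<omega> \<in> space N. emeasure lborel (Pair \<omega> -` ?Q) = 0}"
  proof (intro Collect_cong conj_cong refl)
    fix \<omega> assume \<omega>: "\<omega> \<in> space N"
    have "(\<lambda>x. g \<omega> x) \<in> borel_measurable borel"
      using measurable_compose[OF measurable_Pair1'[OF \<omega>] g] by simp
    then have "Linf_norm_on A (g \<omega>) \<le> C \<longleftrightarrow> emeasure lborel {x \<in> A. C < ennreal \<bar>g \<omega> x\<bar>} = 0"
      by (intro Linf_norm_on_le_iff A)
    moreover have "Pair \<omega> -` ?Q = {x \<in> A. C < ennreal \<bar>g \<omega> x\<bar>}"
      using \<omega> by (auto simp: space_pair_measure)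
    ultimately show "Linf_norm_on A (g \<omega>) \<le> C \<longleftrightarrow> emeasure lborel (Pair \<omega> -` ?Q) = 0" by simp
  qed
  also have "\<dots> \<in> sets N" by measurable
  finally show ?thesis .
qed

section \<open>Almost every transform is admissible\<close>

lemma AE_uniform_interval:
  assumes "a \<le> b"
  shows "AE x in uniform_interval a b. a \<le> x \<and> x \<le> b"
proof (cases "a < b")
  case True
  then have "AE x in uniform_measure lborel {a..b}. a \<le> x \<and> x \<le> b"
    by (intro AE_uniform_measureI) auto
  then show ?thesis using True unfolding uniform_interval_def by simp
next
  case False
  then have "AE x in return borel a. a \<le> x \<and> x \<le> b"
    using assms by (subst AE_return) auto
  then show ?thesis using False unfolding uniform_interval_def by simp
qed

lemma AE_scale_law:
  assumes "0 < hlo" "hlo \<le> hup"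
  shows "AE s in (scale_law hlo hup :: (real ^ 'd::finite) measure).
           \<forall>i. 1 / hup \<le> s $ i \<and> s $ i \<le> 1 / hlo"
proof -
  let ?U = "uniform_interval (ln (1 / hup)) (ln (1 / hlo))"
  let ?M = "\<Pi>\<^sub>M i\<in>(UNIV :: 'd set). ?U"
  have [measurable]: "(\<lambda>u. \<chi> i. exp (u i)) \<in> ?M \<rightarrow>\<^sub>M (borel :: (real ^ 'd) measure)"
  proof -
    have "(\<lambda>u. exp (u i)) \<in> borel_measurable ?M" for i by measurable
    then show ?thesis
      by (subst borel_measurable_euclidean_space) (auto simp: Basis_vec_def inner_axis)
  qed
  have "AE u in ?M. ln (1 / hup) \<le> u i \<and> u i \<le> ln (1 / hlo)" for i
    using assms
    by (intro AE_PiM_component prob_space_uniform_interval AE_uniform_interval)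
      (auto simp: frac_le)
  then have "AE u in ?M. \<forall>i. ln (1 / hup) \<le> u i \<and> u i \<le> ln (1 / hlo)"
    by (intro eventually_all_finite) simp_all
  then have "AE u in ?M. \<forall>i. 1 / hup \<le> exp (u i) \<and> exp (u i) \<le> 1 / hlo"
  proof eventually_elim
    case (elim u)
    show ?case
    proof
      fix i
      have "exp (ln (1 / hup)) \<le> exp (u i)" "exp (u i) \<le> exp (ln (1 / hlo))"
        using elim by simp_all
      then show "1 / hup \<le> exp (u i) \<and> exp (u i) \<le> 1 / hlo" using assms by simp
    qed
  qed
  then show ?thesis
    unfolding scale_law_def by (subst AE_distr_iff) auto
qed

lemma AE_admissible_transform:
  fixes \<rho> :: "(real ^ 'd ^ 'd::finite) measure"
  assumes \<rho>: "uniform_rotation_law \<rho>" and h: "0 < hlo" "hlo \<le> hup"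
  shows "AE H in hist_law \<rho> hlo hup. admissible_transform hlo hup H"
proof -
  let ?S = "scale_law hlo hup :: (real ^ 'd) measure" and ?B = "shift_law :: (real ^ 'd) measure"
  interpret R: prob_space \<rho> using \<rho> by (simp add: uniform_rotation_law_def)
  interpret S: prob_space ?S by (rule prob_space_scale_law)
  interpret B: prob_space ?B by (rule prob_space_shift_law)
  interpret SB: pair_prob_space ?S ?B ..
  interpret RSB: pair_prob_space \<rho> "?S \<Otimes>\<^sub>M ?B" ..
  have [measurable_cong]: "sets \<rho> = sets borel" "sets ?S = sets borel"
    using \<rho> by (auto simp: uniform_rotation_law_def scale_law_def)
  have "AE R in \<rho>. orthogonal_matrix R"
    using \<rho> by (auto simp: uniform_rotation_law_def rotation_matrix_def elim: eventually_mono)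
  then have 1: "AE H in hist_law \<rho> hlo hup. orthogonal_matrix (fst H)"
    unfolding hist_law_def
    by (intro AE_distrD[of fst _ \<rho>]) (simp, subst SB.P.distr_pair_fst)
  have "AE p in ?S \<Otimes>\<^sub>M ?B. \<forall>i. 1 / hup \<le> fst p $ i \<and> fst p $ i \<le> 1 / hlo"
    using AE_scale_law[OF h]
    by (intro AE_distrD[of fst _ ?S]) (simp, subst B.distr_pair_fst)
  then have 2: "AE H in hist_law \<rho> hlo hup. \<forall>i. 1 / hup \<le> fst (snd H) $ i \<and> fst (snd H) $ i \<le> 1 / hlo"
    unfolding hist_law_def
    by (intro RSB.AE_pair_measure) auto
  show ?thesis using 1 2
    by eventually_elim (auto simp: admissible_transform_def split: prod.split)
qed

section \<open>Bias and mass of a bin\<close>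

text \<open>With \<open>l\<close> and \<open>u\<close> close to the value of \<open>f\<close> at a point this bounds the bias of a
  histogram, and with a global bound \<open>u\<close> it bounds the mass of a bin.\<close>

lemma measure_density_bounds:
  fixes f :: "real ^ 'd::finite \<Rightarrow> real"
  assumes f [measurable]: "f \<in> borel_measurable borel" and nonneg: "\<And>x. 0 \<le> f x"
    and P: "prob_space P" "P = density lborel (\<lambda>x. ennreal (f x))"
    and A: "A \<in> fmeasurable lborel" and bounds: "\<And>y. y \<in> A \<Longrightarrow> l \<le> f y \<and> f y \<le> u"
  shows "l * measure lborel A \<le> measure P A" and "measure P A \<le> u * measure lborel A"
proof -
  have [measurable]: "A \<in> sets borel" using A by (auto simp: fmeasurable_def)
  have int1: "integrable lborel f"
  proof (rule integrableI_nonneg)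
    have "emeasure P (space P) = 1" using P(1) by (rule prob_space.emeasure_space_1)
    then show "(\<integral>\<^sup>+x. ennreal (f x) \<partial>lborel) < \<infinity>"
      by (simp add: P(2) emeasure_density)
  qed (use nonneg in auto)
  have "integrable lborel (\<lambda>x. indicator A x *\<^sub>R f x)"
    using int1 by (intro integrable_mult_indicator) auto
  then have int: "integrable lborel (\<lambda>x. f x * indicator A x)" by (simp add: mult.commute)
  have "emeasure P A = (\<integral>\<^sup>+x. ennreal (f x * indicator A x) \<partial>lborel)"
    using nonneg unfolding P(2)
    by (subst emeasure_density) (auto intro!: nn_integral_cong simp: indicator_def)
  also have "\<dots> = ennreal (\<integral>x. f x * indicator A x \<partial>lborel)"
    using nonneg int by (intro nn_integral_eq_integral) auto
  finally have PA: "measure P A = (\<integral>x. f x * indicator A x \<partial>lborel)"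
    using nonneg by (simp add: measure_def integral_nonneg_AE)
  have indA: "integrable lborel (\<lambda>x. c * indicator A x :: real)" for c
    using A by (intro integrable_mult_right integrable_real_indicator) (auto simp: fmeasurable_def)
  have intA: "(\<integral>x. c * indicator A x \<partial>lborel) = c * measure lborel A" for c :: real
    by simp
  have "(\<integral>x. l * indicator A x \<partial>lborel) \<le> (\<integral>x. f x * indicator A x \<partial>lborel)"
    by (rule integral_mono[OF indA int]) (use bounds in \<open>auto simp: indicator_def\<close>)
  then show "l * measure lborel A \<le> measure P A" by (simp only: PA intA)
  have "(\<integral>x. f x * indicator A x \<partial>lborel) \<le> (\<integral>x. u * indicator A x \<partial>lborel)"
    by (rule integral_mono[OF int indA]) (use bounds in \<open>auto simp: indicator_def\<close>)
  then show "measure P A \<le> u * measure lborel A" by (simp only: PA intA)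
qed

lemma norm_le_of_mem_cube:
  fixes x :: "real ^ 'd::finite"
  assumes "x \<in> cube (- r) r"
  shows "norm x \<le> sqrt (real CARD('d)) * r"
proof -
  have "- r \<le> x $ undefined \<and> x $ undefined \<le> r" using assms by (simp add: cube_def)
  then have r: "0 \<le> r" by linarith
  have "(\<Sum>i\<in>UNIV. (x $ i)\<^sup>2) \<le> (\<Sum>i\<in>(UNIV :: 'd set). r\<^sup>2)"
    using assms r by (intro sum_mono) (auto simp: cube_def abs_le_square_iff[symmetric] abs_le_iff minus_le_iff)
  then have "norm x \<le> sqrt (real CARD('d) * r\<^sup>2)"
    by (simp add: norm_vec_def L2_set_def)
  also have "\<dots> = sqrt (real CARD('d)) * r" using r by (simp add: real_sqrt_mult)
  finally show ?thesis .
qed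

section \<open>Error of a single histogram\<close>

text \<open>The samples for which some bin inside the cube has an empirical frequency that is off by at
  least \<open>a / n\<close>.  Outside this event the histogram is accurate at all interior points at once, as
  it depends on the point only through its bin.\<close>

definition deviating_samples ::
  "(real ^ 'd) measure \<Rightarrow> real \<Rightarrow> nat \<Rightarrow> real \<Rightarrow> ('d::finite) hist_transform
     \<Rightarrow> (nat \<Rightarrow> real ^ 'd) set" where
  "deviating_samples P r n a H =
     (\<Union>A\<in>bins_within r H. {X \<in> space (\<Pi>\<^sub>M i\<in>{1..n}. P).
        a \<le> \<bar>\<Sum>i=1..n. indicator A (X i) - measure P A\<bar>})"

text \<open>Union bound over the finitely many bins.  It is legitimate because the transform is fixed here:
  the bins do not depend on the sample.\<close>

lemma emeasure_deviating_samples_le: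
  fixes H :: "('d::finite) hist_transform"
  assumes P: "prob_space P" "sets P = sets borel"
    and H: "admissible_transform hlo hup H" and h: "0 < hlo" "0 < hup" and r: "0 \<le> r"
    and s: "0 < s" "s \<le> 1" and p: "\<And>A. A \<in> bins_within r H \<Longrightarrow> measure P A \<le> p"
  shows "deviating_samples P r n a H \<in> sets (\<Pi>\<^sub>M i\<in>{1..n}. P)"
    and "emeasure (\<Pi>\<^sub>M i\<in>{1..n}. P) (deviating_samples P r n a H)
      \<le> ennreal ((2 * r) ^ CARD('d) / (hlo / sqrt (real CARD('d))) ^ CARD('d)
          * (2 * exp (real n * (p * s\<^sup>2) - s * a)))"
proof -
  let ?M = "\<Pi>\<^sub>M i\<in>{1..n}. P" and ?e = "2 * exp (real n * (p * s\<^sup>2) - s * a)"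
  let ?D = "\<lambda>A. {X \<in> space ?M. a \<le> \<bar>\<Sum>i=1..n. indicator A (X i) - measure P A\<bar>}"
  note card = card_bins_within_le[OF H h r]
  have sets_bin: "A \<in> sets P" if "A \<in> bins_within r H" for A
    using that P(2) by (auto simp: bins_within_def)
  have D: "?D A \<in> sets ?M" if "A \<in> bins_within r H" for A
  proof -
    note [measurable] = sets_bin[OF that]
    show ?thesis by measurable
  qed
  then show "deviating_samples P r n a H \<in> sets ?M"
    unfolding deviating_samples_def using card(1) by (intro sets.finite_UN) auto
  have "emeasure ?M (deviating_samples P r n a H) \<le> (\<Sum>A\<in>bins_within r H. emeasure ?M (?D A))"
    unfolding deviating_samples_def using card(1) D
    by (intro emeasure_subadditive_finite) auto
  also have "\<dots> \<le> (\<Sum>A\<in>bins_within r H. ennreal ?e)"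
  proof (rule sum_mono)
    fix A assume A: "A \<in> bins_within r H"
    have "emeasure ?M (?D A) \<le> ennreal (2 * exp (real (card {1..n}) * (measure P A * s\<^sup>2) - s * a))"
      by (rule emeasure_PiM_deviation_le[OF P(1) sets_bin[OF A] _ s]) simp
    also have "\<dots> \<le> ennreal ?e"
      using p[OF A] by (intro ennreal_leI) (auto intro!: mult_left_mono mult_right_mono)
    finally show "emeasure ?M (?D A) \<le> ennreal ?e" .
  qed
  also have "\<dots> = ennreal (real (card (bins_within r H)) * ?e)"
    by (simp add: ennreal_of_nat_eq_real_of_nat ennreal_mult)
  also have "\<dots> \<le> ennreal ((2 * r) ^ CARD('d) / (hlo / sqrt (real CARD('d))) ^ CARD('d) * ?e)"
    using card(2) by (intro ennreal_leI mult_right_mono) auto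
  finally show "emeasure ?M (deviating_samples P r n a H)
      \<le> ennreal ((2 * r) ^ CARD('d) / (hlo / sqrt (real CARD('d))) ^ CARD('d) * ?e)" .
qed

lemma hist_bin_subset_cube:
  fixes H :: "('d::finite) hist_transform"
  assumes H: "admissible_transform hlo hup H" and h: "0 < hup"
    and x: "x \<in> cube (sqrt (real CARD('d)) * hup) (r - sqrt (real CARD('d)) * hup)"
  shows "hist_bin H x \<subseteq> cube (- r) r"
proof
  let ?\<delta> = "sqrt (real CARD('d)) * hup"
  fix y assume y: "y \<in> hist_bin H x"
  have "0 \<le> ?\<delta>" using h by simp
  moreover have "\<bar>(y - x) $ i\<bar> \<le> ?\<delta>" for i
    using component_le_norm_cart[of "y - x" i] hist_bin_diameter_le[OF H h y] by linarith
  then have "\<bar>y $ i - x $ i\<bar> \<le> ?\<delta>" for i by simp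
  moreover have "?\<delta> \<le> x $ i" "x $ i \<le> r - ?\<delta>" for i using x by (auto simp: cube_def)
  ultimately have "- r \<le> y $ i \<and> y $ i \<le> r" for i
    by (smt (verit))
  then show "y \<in> cube (- r) r" by (simp add: cube_def)
qed

text \<open>The error splits into the stochastic part \<open>(D A - P A) / \<mu> A\<close> and the bias
  \<open>P A / \<mu> A - f x\<close>, where \<open>A\<close> is the bin of \<open>x\<close>, \<open>D\<close> the empirical
  measure and \<open>\<mu>\<close> Lebesgue measure.\<close>

lemma hist_density_error_le:
  fixes H :: "('d::finite) hist_transform"
  assumes f: "f \<in> borel_measurable borel" "\<And>x. 0 \<le> f x"
    and P: "prob_space P" "P = density lborel (\<lambda>x. ennreal (f x))"
    and H: "admissible_transform hlo hup H" and h: "0 < hlo" "0 < hup"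
    and osc: "\<And>y. y \<in> hist_bin H x \<Longrightarrow> \<bar>f y - f x\<bar> \<le> \<delta>"
    and inside: "hist_bin H x \<subseteq> cube (- r) r"
    and X: "X \<in> space (\<Pi>\<^sub>M i\<in>{1..n}. P)" "X \<notin> deviating_samples P r n (real n * \<epsilon>) H"
    and n: "0 < n"
  shows "\<bar>hist_density r (empirical_measure n X) H x - f x\<bar>
    \<le> \<epsilon> / (hlo / sqrt (real CARD('d))) ^ CARD('d) + \<delta>"
proof -
  define A where "A = hist_bin H x"
  define v where "v = measure lborel A"
  let ?v0 = "(hlo / sqrt (real CARD('d))) ^ CARD('d)"
  define S where "S = (\<Sum>i=1..n. indicator A (X i) :: real)"
  have v0: "0 < ?v0" using h by (simp add: card_gt_0_iff)
  have v: "?v0 \<le> v" unfolding v_def A_def by (rule measure_hist_bin_ge[OF H h])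
  have xA: "x \<in> A" by (simp add: A_def hist_bin_def)
  have fA: "f x - \<delta> \<le> f y \<and> f y \<le> f x + \<delta>" if "y \<in> A" for y
    using osc[of y] that by (auto simp: A_def abs_le_iff)
  note bounds = measure_density_bounds[OF f P fmeasurable_hist_bin[OF H h(2)], of x,
      folded A_def, OF fA, folded v_def]
  have bias: "\<bar>measure P A / v - f x\<bar> \<le> \<delta>"
  proof -
    have "0 < v" using v v0 by linarith
    then have "f x - \<delta> \<le> measure P A / v" "measure P A / v \<le> f x + \<delta>"
      using bounds by (simp_all add: pos_le_divide_eq pos_divide_le_eq)
    then show ?thesis by (simp add: abs_le_iff)
  qed
  have "A \<in> bins_within r H" using inside by (auto simp: bins_within_def A_def)
  then have "\<bar>\<Sum>i=1..n. indicator A (X i) - measure P A\<bar> < real n * \<epsilon>"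
    using X by (auto simp: deviating_samples_def not_le)
  then have dev: "\<bar>S - real n * measure P A\<bar> \<le> real n * \<epsilon>"
    by (simp add: S_def sum_subtractf)
  then have eps: "0 \<le> \<epsilon>" using n by (smt (verit) mult_pos_neg of_nat_0_less_iff)
  have vpos: "0 < v" using v v0 by linarith
  have "S / real n / v - measure P A / v = (S - real n * measure P A) / (real n * v)"
    using n vpos by (simp add: field_simps)
  then have "\<bar>S / real n / v - measure P A / v\<bar> = \<bar>S - real n * measure P A\<bar> / (real n * v)"
    using n vpos by (simp add: abs_mult)
  also have "\<dots> \<le> real n * \<epsilon> / (real n * v)"
    using dev n vpos by (intro divide_right_mono) auto
  also have "\<dots> = \<epsilon> / v" using n by simp
  also have "\<dots> \<le> \<epsilon> / ?v0" using v v0 eps by (intro divide_left_mono) auto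
  finally have stoch: "\<bar>S / real n / v - measure P A / v\<bar> \<le> \<epsilon> / ?v0" .
  have "A \<inter> cube (- r) r = A" "x \<in> cube (- r) r" using inside xA by (auto simp: A_def)
  then have "hist_density r (empirical_measure n X) H x = S / real n / v"
    by (simp add: hist_density_empirical A_def[symmetric] S_def v_def)
  then show ?thesis using stoch bias by linarith
qed

section \<open>Error of the ensemble\<close>

lemma ensemble_density_error_le:
  assumes T: "1 \<le> T"
    and err: "\<And>t. t \<in> {1..T} \<Longrightarrow> \<bar>hist_density r (empirical_measure n X) (H t) x - y\<bar> \<le> e"
  shows "\<bar>ensemble_density r n T X H x - y\<bar> \<le> e"
proof -
  let ?g = "\<lambda>t. hist_density r (empirical_measure n X) (H t) x"
  have "ensemble_density r n T X H x - y = (\<Sum>t=1..T. ?g t - y) / real T"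
    using T by (simp add: ensemble_density_def sum_subtractf field_simps)
  moreover have "\<bar>\<Sum>t=1..T. ?g t - y\<bar> \<le> (\<Sum>t=1..T. e)"
    using err by (intro order_trans[OF sum_abs] sum_mono)
  ultimately show ?thesis
    using T by (simp add: pos_divide_le_eq mult.commute)
qed

text \<open>Conditioning on the second component, in the form of Fubini's theorem for the complement.\<close>

lemma measure_pair_ge_of_slices:
  assumes M1: "prob_space M1" and M2: "prob_space M2"
    and E: "E \<in> sets (M1 \<Otimes>\<^sub>M M2)" and b: "0 \<le> b"
    and slice: "AE y in M2. emeasure M1 {x \<in> space M1. (x, y) \<notin> E} \<le> ennreal b"
  shows "1 - b \<le> measure (M1 \<Otimes>\<^sub>M M2) E"
proof -
  interpret M1: prob_space M1 by fact
  interpret M2: prob_space M2 by fact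
  interpret M: pair_prob_space M1 M2 ..
  let ?M = "M1 \<Otimes>\<^sub>M M2"
  have "emeasure ?M (space ?M - E) = (\<integral>\<^sup>+y. emeasure M1 ((\<lambda>x. (x, y)) -` (space ?M - E)) \<partial>M2)"
    using E by (intro M.emeasure_pair_measure_alt2) auto
  also have "\<dots> \<le> (\<integral>\<^sup>+y. ennreal b \<partial>M2)"
  proof (rule nn_integral_mono_AE)
    show "AE y in M2. emeasure M1 ((\<lambda>x. (x, y)) -` (space ?M - E)) \<le> ennreal b"
      using slice AE_space
    proof eventually_elim
      case (elim y)
      then have "(\<lambda>x. (x, y)) -` (space ?M - E) = {x \<in> space M1. (x, y) \<notin> E}"
        by (auto simp: space_pair_measure)
      then show ?case using elim by simp
    qed
  qed
  also have "\<dots> = ennreal b" by (simp add: M2.emeasure_space_1)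
  finally have "M.P.prob (space ?M - E) \<le> b"
    using b by (simp add: M.P.emeasure_eq_measure)
  then show ?thesis using M.P.prob_compl[OF E] by simp
qed

text \<open>A bound for a fixed sample size: \<open>\<epsilon>\<close> is the tolerated deviation of the bin
  frequencies and \<open>s\<close> the free parameter of the Chernoff bound.  The two are tuned against the
  bin width only in the asymptotic statement.\<close>

lemma ensemble_density_finite_sample:
  fixes P :: "(real ^ 'd::finite) measure" and \<rho> :: "(real ^ 'd ^ 'd) measure"
  defines "R \<equiv> sqrt (real CARD('d))"
  assumes f: "f \<in> borel_measurable borel" "\<And>x. 0 \<le> f x"
    and P: "prob_space P" "P = density lborel (\<lambda>x. ennreal (f x))"
    and \<rho>: "uniform_rotation_law \<rho>" and T: "1 \<le> T" and n: "0 < n" and r: "0 \<le> r"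
    and h: "0 < hlo" "hlo \<le> hup" and s: "0 < s" "s \<le> 1"
    and hoelder: "0 \<le> cL" "0 \<le> \<alpha>"
      "\<And>x y. x \<in> cube (- r) r \<Longrightarrow> y \<in> cube (- r) r \<Longrightarrow> \<bar>f x - f y\<bar> \<le> cL * norm (x - y) powr \<alpha>"
    and F: "\<And>x. x \<in> cube (- r) r \<Longrightarrow> f x \<le> F"
    and e: "\<epsilon> / (hlo / R) ^ CARD('d) + cL * (R * hup) powr \<alpha> \<le> e"
  shows "1 - real T * ((2 * r) ^ CARD('d) / (hlo / R) ^ CARD('d)
        * (2 * exp (real n * (F * (2 * (R * hup)) ^ CARD('d) * s\<^sup>2) - s * (real n * \<epsilon>))))
    \<le> measure (sample_law P \<rho> n T hlo hup)
      {\<omega> \<in> space (sample_law P \<rho> n T hlo hup).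
        Linf_norm_on (cube (R * hup) (r - R * hup))
          (\<lambda>x. ensemble_density r n T (fst \<omega>) (snd \<omega>) x - f x)
        \<le> ennreal e}"
proof -
  let ?M1 = "\<Pi>\<^sub>M i\<in>{1..n}. P" and ?M2 = "\<Pi>\<^sub>M t\<in>{1..T}. hist_law \<rho> hlo hup"
  let ?B = "cube (R * hup) (r - R * hup) :: (real ^ 'd) set"
  let ?q = "(2 * r) ^ CARD('d) / (hlo / R) ^ CARD('d)
        * (2 * exp (real n * (F * (2 * (R * hup)) ^ CARD('d) * s\<^sup>2) - s * (real n * \<epsilon>)))"
  let ?g = "\<lambda>\<omega> x. ensemble_density r n T (fst \<omega>) (snd \<omega>) x - f x"
  let ?E = "{\<omega> \<in> space (?M1 \<Otimes>\<^sub>M ?M2). Linf_norm_on ?B (?g \<omega>) \<le> ennreal e}"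
  have hup: "0 < hup" using h by simp
  have q: "0 \<le> ?q" using r h by (simp add: R_def)
  have Psets: "sets P = sets borel" by (simp add: P(2))
  have M1: "prob_space ?M1" using P(1) by (intro prob_space_PiM)
  have M2: "prob_space ?M2" by (intro prob_space_PiM prob_space_hist_law[OF \<rho>])
  have g: "(\<lambda>p. ?g (fst p) (snd p)) \<in> borel_measurable ((?M1 \<Otimes>\<^sub>M ?M2) \<Otimes>\<^sub>M borel)"
    using borel_measurable_ensemble_density[OF Psets sets_hist_law[OF \<rho>]] f(1)
    by (intro borel_measurable_diff measurable_compose[OF measurable_snd f(1)])
  have E: "?E \<in> sets (?M1 \<Otimes>\<^sub>M ?M2)"
    by (rule sets_Linf_norm_on_le[OF g sets_cube])
  have bin_mass: "measure P A \<le> F * (2 * (R * hup)) ^ CARD('d)"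
    if H: "admissible_transform hlo hup H" and A: "A \<in> bins_within r H" for A H
  proof -
    obtain x where x: "A = hist_bin H x" "hist_bin H x \<subseteq> cube (- r) r"
      using A by (auto simp: bins_within_def)
    have xc: "x \<in> cube (- r) r" using x(2) by (auto simp: hist_bin_def)
    have "measure P A \<le> F * measure lborel A" unfolding x(1)
      by (rule measure_density_bounds(2)[OF f P fmeasurable_hist_bin[OF H hup], where l = 0])
        (use F f(2) x(2) in auto)
    also have "\<dots> \<le> F * (2 * (R * hup)) ^ CARD('d)"
      using measure_hist_bin_le[OF H hup, of x] F[OF xc] f(2)[of x]
      unfolding x(1) R_def by (intro mult_left_mono) auto
    finally show ?thesis .
  qed
  have slice: "emeasure ?M1 {X \<in> space ?M1. (X, Hs) \<notin> ?E} \<le> ennreal (real T * ?q)"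
    if adm: "\<forall>t\<in>{1..T}. admissible_transform hlo hup (Hs t)" and Hs: "Hs \<in> space ?M2" for Hs
  proof -
    let ?D = "\<lambda>t. deviating_samples P r n (real n * \<epsilon>) (Hs t)"
    have D: "?D t \<in> sets ?M1" "emeasure ?M1 (?D t) \<le> ennreal ?q" if t: "t \<in> {1..T}" for t
    proof -
      have H: "admissible_transform hlo hup (Hs t)" using adm t by blast
      show "?D t \<in> sets ?M1" "emeasure ?M1 (?D t) \<le> ennreal ?q"
        using emeasure_deviating_samples_le[OF P(1) Psets H h(1) hup r s bin_mass[OF H],
          of n "real n * \<epsilon>"]
        by (simp_all add: R_def)
    qed
    then have U: "(\<Union>t\<in>{1..T}. ?D t) \<in> sets ?M1" by (intro sets.finite_UN) blast+
    have sub: "{X \<in> space ?M1. (X, Hs) \<notin> ?E} \<subseteq> (\<Union>t\<in>{1..T}. ?D t)"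
    proof (rule subsetI, rule ccontr)
      fix X assume "X \<in> {X \<in> space ?M1. (X, Hs) \<notin> ?E}" and "X \<notin> (\<Union>t\<in>{1..T}. ?D t)"
      then have X: "X \<in> space ?M1" "(X, Hs) \<notin> ?E" and nd: "\<And>t. t \<in> {1..T} \<Longrightarrow> X \<notin> ?D t"
        by auto
      have \<omega>: "(X, Hs) \<in> space (?M1 \<Otimes>\<^sub>M ?M2)" using X Hs by (simp add: space_pair_measure)
      have err: "\<bar>?g (X, Hs) x\<bar> \<le> e" if x: "x \<in> ?B" for x
        unfolding fst_conv snd_conv
      proof (rule ensemble_density_error_le[OF T])
        fix t assume t: "t \<in> {1..T}"
        have H: "admissible_transform hlo hup (Hs t)" using adm t by blast
        have inside: "hist_bin (Hs t) x \<subseteq> cube (- r) r"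
          using hist_bin_subset_cube[OF H hup] x by (simp add: R_def)
        have osc: "\<bar>f y - f x\<bar> \<le> cL * (R * hup) powr \<alpha>" if y: "y \<in> hist_bin (Hs t) x" for y
        proof -
          have "x \<in> hist_bin (Hs t) x" by (simp add: hist_bin_def)
          then have "\<bar>f y - f x\<bar> \<le> cL * norm (y - x) powr \<alpha>"
            using inside y by (intro hoelder(3)) auto
          also have "\<dots> \<le> cL * (R * hup) powr \<alpha>"
            using hist_bin_diameter_le[OF H hup y] hoelder(1,2) unfolding R_def
            by (intro mult_left_mono powr_mono2) auto
          finally show ?thesis .
        qed
        show "\<bar>hist_density r (empirical_measure n X) (Hs t) x - f x\<bar> \<le> e"
          using hist_density_error_le[OF f P H h(1) hup osc inside X(1) nd[OF t] n]
          using e by (simp add: R_def)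
      qed
      have "(\<lambda>x. ?g (X, Hs) x) \<in> borel_measurable borel"
        using measurable_compose[OF measurable_Pair1'[OF \<omega>] g] by simp
      moreover have "emeasure lborel {x \<in> ?B. ennreal e < ennreal \<bar>?g (X, Hs) x\<bar>} = 0"
      proof -
        have "{x \<in> ?B. ennreal e < ennreal \<bar>?g (X, Hs) x\<bar>} = {}"
          using err by (auto simp: not_less intro!: ennreal_leI simp del: fst_conv snd_conv)
        then show ?thesis by (simp only: emeasure_empty)
      qed
      ultimately have "Linf_norm_on ?B (?g (X, Hs)) \<le> ennreal e"
        using Linf_norm_on_le_iff sets_cube by blast
      then show False using X(2) \<omega> by simp
    qed
    have "emeasure ?M1 {X \<in> space ?M1. (X, Hs) \<notin> ?E} \<le> emeasure ?M1 (\<Union>t\<in>{1..T}. ?D t)"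
      by (rule emeasure_mono[OF sub U])
    also have "\<dots> \<le> (\<Sum>t\<in>{1..T}. emeasure ?M1 (?D t))"
      using D(1) by (intro emeasure_subadditive_finite) blast+
    also have "\<dots> \<le> (\<Sum>t\<in>{1..T}. ennreal ?q)"
      using D(2) by (rule sum_mono)
    also have "\<dots> = ennreal (real T * ?q)"
      using q by (simp only: sum_constant card_atLeastAtMost ennreal_of_nat_eq_real_of_nat
          ennreal_mult[OF of_nat_0_le_iff]) simp
    finally show ?thesis .
  qed
  have "AE Hs in ?M2. \<forall>t\<in>{1..T}. admissible_transform hlo hup (Hs t)"
    by (intro eventually_ball_finite ballI AE_PiM_component prob_space_hist_law[OF \<rho>]
        AE_admissible_transform[OF \<rho> h]) auto
  then have "AE Hs in ?M2. emeasure ?M1 {X \<in> space ?M1. (X, Hs) \<notin> ?E} \<le> ennreal (real T * ?q)"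
    using AE_space by eventually_elim (rule slice)
  from measure_pair_ge_of_slices[OF M1 M2 E _ this]
  show ?thesis using r h by (simp add: sample_law_def R_def)
qed

section \<open>The convergence rate\<close>

theorem theorem7:
  fixes P :: "(real ^ 'd::finite) measure"
    and f :: "real ^ 'd \<Rightarrow> real"
    and \<rho> :: "(real ^ 'd ^ 'd) measure"
    and \<alpha> r :: real
    and T :: nat
    and hlo hup c0 :: "nat \<Rightarrow> real"
  assumes "prob_space P"
    and "f \<in> borel_measurable borel" and "\<And>x. 0 \<le> f x"
    and "P = density lborel (\<lambda>x. ennreal (f x))"
    and "0 < r" and "measure_support P \<subseteq> cube (- r) r"
    and "0 < \<alpha>" and "\<alpha> \<le> 1" and "hoelder_on \<alpha> (cube (- r) r) f"
    and "uniform_rotation_law \<rho>"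
    and "1 \<le> T"
    and "\<And>n. hlo n = (ln (real n) / real n) powr (1 / (2 * \<alpha> + real CARD('d)))"
    and "\<And>n. 2 \<le> n \<Longrightarrow> hlo n \<le> hup n"
    and "\<And>n. 2 \<le> n \<Longrightarrow> c0 n * hup n \<le> hlo n \<and> hlo n \<le> inverse (c0 n) * hup n"
    and "\<And>n. 2 \<le> n \<Longrightarrow> 0 < c0 n \<and> c0 n < 1"
    and "\<exists>\<epsilon>>0. \<forall>n\<ge>2. \<epsilon> \<le> c0 n"
  shows "\<exists>c>0. \<exists>N0::nat. \<forall>n\<ge>N0.
    \<P>(\<omega> in sample_law P \<rho> n T (hlo n) (hup n).
        Linf_norm_on (cube (sqrt (real CARD('d)) * hup n) (r - sqrt (real CARD('d)) * hup n))
          (\<lambda>x. ensemble_density r n T (fst \<omega>) (snd \<omega>) x - f x)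
        \<le> ennreal (c * (ln (real n) / real n) powr (\<alpha> / (2 * \<alpha> + real CARD('d)))))
      \<ge> 1 - real T / real n"
proof -
  obtain cL where cL: "0 < cL" and hoelder:
    "\<And>x y. x \<in> cube (- r) r \<Longrightarrow> y \<in> cube (- r) r \<Longrightarrow> \<bar>f x - f y\<bar> \<le> cL * norm (x - y) powr \<alpha>"
    using assms(9) unfolding hoelder_on_def by blast
  obtain \<epsilon>0 where \<epsilon>0: "0 < \<epsilon>0" and c0: "\<And>n. 2 \<le> n \<Longrightarrow> \<epsilon>0 \<le> c0 n"
    using assms(16) by blast
  define d where "d = CARD('d)"
  define R where "R = sqrt (real CARD('d))"
  have R: "0 < R" by (simp add: R_def card_gt_0_iff)
  define F where "F = \<bar>f 0\<bar> + cL * (R * r) powr \<alpha>"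
  have F0: "0 \<le> F" using cL by (simp add: F_def)
  have F: "f x \<le> F" if x: "x \<in> cube (- r) r" for x
  proof -
    have "\<bar>f x - f 0\<bar> \<le> cL * norm (x - 0) powr \<alpha>"
      using x assms(5) by (intro hoelder) (simp_all add: cube_def)
    also have "\<dots> \<le> cL * (R * r) powr \<alpha>"
      using norm_le_of_mem_cube[OF x] cL assms(7) unfolding R_def
      by (intro mult_left_mono powr_mono2) auto
    finally show ?thesis by (simp add: F_def)
  qed
  \<comment> \<open>All bins inside the cube have mass at most \<open>K * h ^ d\<close> and volume at least
    \<open>v0 * h ^ d\<close>, and there are at most \<open>q * n\<close> of them.\<close>
  define K where "K = F * (2 * R / \<epsilon>0) ^ d"
  have K: "0 \<le> K" using F0 R \<epsilon>0 by (simp add: K_def)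
  define v0 where "v0 = (1 / R) ^ d"
  have v0: "0 < v0" using R by (simp add: v0_def)
  define q where "q = (2 * r) ^ d / v0"
  have q: "0 \<le> q" using v0 assms(5) by (simp add: q_def)
  define c where "c = (K + 3) / v0 + cL * (R / \<epsilon>0) powr \<alpha>"
  have c: "0 < c" using K v0 cL by (simp add: c_def add_pos_nonneg)
  have main: "1 - real T / real n \<le> \<P>(\<omega> in sample_law P \<rho> n T (hlo n) (hup n).
        Linf_norm_on (cube (R * hup n) (r - R * hup n))
          (\<lambda>x. ensemble_density r n T (fst \<omega>) (snd \<omega>) x - f x)
        \<le> ennreal (c * (ln (real n) / real n) powr (\<alpha> / (2 * \<alpha> + real d))))"
    if n3: "3 \<le> n" and nq: "2 * q \<le> real n" for n
  proof -
    define h where "h = hlo n"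
    define s where "s = h powr \<alpha>"
    define x where "x = ln (real n) / real n"
    \<comment> \<open>The bin width balances bias and fluctuation: \<open>n * (s\<^sup>2 * h ^ d) = ln n\<close> for the
      rate \<open>s\<close>, which is also the Chernoff parameter.  The exponent of a single bin is then at
      most \<open>K * ln n - (K + 3) * ln n = - 3 * ln n\<close>; of the three powers of \<open>1 / n\<close> one
      pays for the number of bins and one absorbs the constant \<open>2 * q\<close>.\<close>
    let ?\<epsilon> = "(K + 3) * s * h ^ d"
    have "1 \<le> ln (real n)"
      using n3 exp_le by (subst ln_ge_iff) auto
    moreover have "ln (real n) \<le> real n" using n3 ln_le_minus_one[of "real n"] by simp
    ultimately have x: "0 < x" "x \<le> 1" "1 / real n \<le> x"
      using n3 by (auto simp: x_def field_simps)
    have ex: "0 < 2 * \<alpha> + real d" using assms(7) by (simp add: add_pos_nonneg)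
    have hx: "h = x powr (1 / (2 * \<alpha> + real d))" using assms(12) by (simp add: h_def x_def d_def)
    have h: "0 < h" "h \<le> 1" using x ex by (auto simp: hx intro!: powr_le1)
    have s: "0 < s" "s \<le> 1" using h assms(7) by (auto simp: s_def intro!: powr_le1)
    have rate: "s = x powr (\<alpha> / (2 * \<alpha> + real d))"
      using ex by (simp add: s_def hx powr_powr)
    have "s\<^sup>2 = h powr (2 * \<alpha>)" by (simp add: s_def power2_eq_square flip: powr_add)
    moreover have "h ^ d = h powr real d" using h by (simp add: powr_realpow)
    ultimately have "s\<^sup>2 * h ^ d = h powr (2 * \<alpha> + real d)" by (simp only: powr_add)
    also have "\<dots> = x" using ex x by (simp add: hx powr_powr)
    finally have sh: "s\<^sup>2 * h ^ d = x" .
    have hd: "1 / real n \<le> h ^ d"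
    proof -
      have "s\<^sup>2 * h ^ d \<le> 1 * h ^ d" using s h by (intro mult_right_mono) (auto simp: power_le_one)
      then show ?thesis using sh x(3) by simp
    qed
    have hup: "h \<le> hup n" "hup n \<le> h / \<epsilon>0"
    proof -
      show le: "h \<le> hup n" using assms(13) n3 by (simp add: h_def)
      have "\<epsilon>0 * hup n \<le> c0 n * hup n" using c0 n3 le h by (intro mult_right_mono) auto
      also have "\<dots> \<le> h" using assms(14)[of n] n3 by (simp add: h_def)
      finally show "hup n \<le> h / \<epsilon>0" using \<epsilon>0 by (simp add: field_simps)
    qed
    have mass: "F * (2 * (R * hup n)) ^ d \<le> K * h ^ d"
    proof -
      have "(2 * (R * hup n)) ^ d \<le> (2 * (R * (h / \<epsilon>0))) ^ d"
        using hup h R by (intro power_mono mult_left_mono) auto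
      also have "\<dots> = (2 * R / \<epsilon>0) ^ d * h ^ d" by (simp add: mult.assoc flip: power_mult_distrib)
      finally show ?thesis using F0 by (simp add: K_def mult_left_mono mult.assoc)
    qed
    have vol: "(h / R) ^ d = v0 * h ^ d" by (simp add: v0_def power_divide)
    have fail: "(2 * r) ^ d / (h / R) ^ d
        * (2 * exp (real n * (F * (2 * (R * hup n)) ^ d * s\<^sup>2) - s * (real n * ?\<epsilon>))) \<le> 1 / real n"
    proof -
      have nx: "real n * x = ln (real n)" using n3 by (simp add: x_def)
      have "real n * (F * (2 * (R * hup n)) ^ d * s\<^sup>2) - s * (real n * ?\<epsilon>)
          \<le> real n * (K * h ^ d * s\<^sup>2) - s * (real n * ?\<epsilon>)"
        using mass by (intro diff_right_mono mult_left_mono mult_right_mono) auto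
      also have "\<dots> = - 3 * (real n * (s\<^sup>2 * h ^ d))"
        by (simp add: algebra_simps power2_eq_square)
      also have "\<dots> = - 3 * ln (real n)" by (simp add: sh nx)
      finally have "exp (real n * (F * (2 * (R * hup n)) ^ d * s\<^sup>2) - s * (real n * ?\<epsilon>))
          \<le> exp (- 3 * ln (real n))" by simp
      also have "\<dots> = 1 / real n ^ 3"
        using n3 by (simp add: exp_minus exp_of_nat_mult[of 3, simplified] inverse_eq_divide)
      finally have ex3: "exp (real n * (F * (2 * (R * hup n)) ^ d * s\<^sup>2) - s * (real n * ?\<epsilon>))
          \<le> 1 / real n ^ 3" .
      have "(2 * r) ^ d / (h / R) ^ d = q / h ^ d" by (simp add: vol q_def)
      also have "\<dots> \<le> q / (1 / real n)" using hd q h n3 by (intro divide_left_mono) auto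
      finally have bins: "(2 * r) ^ d / (h / R) ^ d \<le> q * real n" by simp
      have "(2 * r) ^ d / (h / R) ^ d
          * (2 * exp (real n * (F * (2 * (R * hup n)) ^ d * s\<^sup>2) - s * (real n * ?\<epsilon>)))
          \<le> (q * real n) * (2 * (1 / real n ^ 3))"
        using bins ex3 q by (intro mult_mono) auto
      also have "\<dots> = (2 * q) / (real n * real n)" using n3 by (simp add: power3_eq_cube)
      also have "\<dots> \<le> real n / (real n * real n)" using nq by (intro divide_right_mono) auto
      finally show ?thesis using n3 by simp
    qed
    have err: "?\<epsilon> / (h / R) ^ d + cL * (R * hup n) powr \<alpha> \<le> c * x powr (\<alpha> / (2 * \<alpha> + real d))"
    proof -
      have "(R * hup n) powr \<alpha> \<le> ((R / \<epsilon>0) * h) powr \<alpha>"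
        using mult_left_mono[OF hup(2), of R] hup(1) h R assms(7)
        by (intro powr_mono2) auto
      also have "\<dots> = (R / \<epsilon>0) powr \<alpha> * s"
        using R \<epsilon>0 h by (subst powr_mult) (auto simp: s_def)
      finally have "cL * (R * hup n) powr \<alpha> \<le> cL * ((R / \<epsilon>0) powr \<alpha> * s)"
        using cL by (intro mult_left_mono) auto
      moreover have "?\<epsilon> / (h / R) ^ d = (K + 3) / v0 * s" using h by (simp add: vol)
      moreover have "c * s = (K + 3) / v0 * s + cL * ((R / \<epsilon>0) powr \<alpha> * s)"
        by (simp add: c_def distrib_right mult.assoc)
      ultimately show ?thesis unfolding rate[symmetric] by (metis add_mono order_refl)
    qed
    let ?S = "sample_law P \<rho> n T (hlo n) (hup n)"
    let ?L = "\<lambda>\<omega>. Linf_norm_on (cube (R * hup n) (r - R * hup n))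
          (\<lambda>x. ensemble_density r n T (fst \<omega>) (snd \<omega>) x - f x)"
    have "1 - real T / real n \<le> 1 - real T * ((2 * r) ^ d / (h / R) ^ d
        * (2 * exp (real n * (F * (2 * (R * hup n)) ^ d * s\<^sup>2) - s * (real n * ?\<epsilon>))))"
      using mult_left_mono[OF fail, of "real T"] by simp
    also have "\<dots> \<le> \<P>(\<omega> in ?S. ?L \<omega> \<le> ennreal (c * x powr (\<alpha> / (2 * \<alpha> + real d))))"
      unfolding R_def d_def h_def
      by (rule ensemble_density_finite_sample[OF assms(2,3,1,4,10,11) _ _ _ _ _ _ _ _ hoelder])
        (use n3 assms(5,7) h(1) hup(1) s cL F err in \<open>auto simp: h_def R_def d_def\<close>)
    finally show ?thesis by (simp add: x_def)
  qed
  show ?thesis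
  proof (intro exI conjI allI impI)
    show "0 < c" by (rule c)
    fix n assume n: "max 3 (nat \<lceil>2 * q\<rceil>) \<le> n"
    then have "3 \<le> n" "2 * q \<le> real n" by (auto simp: nat_le_iff ceiling_le_iff)
    from main[OF this, unfolded R_def d_def]
    show "\<P>(\<omega> in sample_law P \<rho> n T (hlo n) (hup n).
        Linf_norm_on (cube (sqrt (real CARD('d)) * hup n) (r - sqrt (real CARD('d)) * hup n))
          (\<lambda>x. ensemble_density r n T (fst \<omega>) (snd \<omega>) x - f x)
        \<le> ennreal (c * (ln (real n) / real n) powr (\<alpha> / (2 * \<alpha> + real CARD('d)))))
      \<ge> 1 - real T / real n" .
  qed
qed

end
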